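(* Let $G$ be a Frobenius group whose Frobenius kernel $N$ is abelian, and let $H$ be a Frobenius complement. Then there is a set of $|H|$ mutually orthogonal group squares of order $n=|N|$ such that each of the $\binom{|H|+2}{3}$ Latin squares determined by it is isotopic to the Cayley table of $N$.
   Context: A Frobenius group is a finite group $G$ with a non-trivial proper subgroup $H$ (a Frobenius complement) such that $H\cap g^{-1}Hg=1$ for all $g\in G\setminus H$; the identity together with the elements lying in no conjugate of $H$ form a normal subgroup $N$, the Frobenius kernel. A set of $r$ mutually orthogonal Latin squares of order $n$ on the $n\times n$ grid of cells $\Omega$ determines $r+2$ partitions of $\Omega$: into rows, into columns, and, for each square, into the sets of cells carrying the same letter; any three of these partitions determine a Latin square (using two of them as rows and columns and the third as letters), giving $\binom{r+2}{3}$ Latin squares. An isotopism between two Latin squares is a bijection between their cells mapping rows to rows, columns to columns and letters to letters. The set is a set of mutually orthogonal group squares if all these $\binom{r+2}{3}$ Latin squares are isotopic to Cayley tables of groups. *)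

theory Defs
  imports "HOL-Algebra.Coset" "HOL-Library.FuncSet"
begin

definition frobenius_complement :: "('a, 'b) monoid_scheme \<Rightarrow> 'a set \<Rightarrow> bool" where
  "frobenius_complement G H \<longleftrightarrow>
     group G \<and> finite (carrier G) \<and> subgroup H G \<and>
     H \<noteq> {\<one>\<^bsub>G\<^esub>} \<and> H \<noteq> carrier G \<and>
     (\<forall>g \<in> carrier G - H. H \<inter> (inv\<^bsub>G\<^esub> g <#\<^bsub>G\<^esub> (H #>\<^bsub>G\<^esub> g)) = {\<one>\<^bsub>G\<^esub>})"

definition frobenius_kernel :: "('a, 'b) monoid_scheme \<Rightarrow> 'a set \<Rightarrow> 'a set" where
  "frobenius_kernel G H =
     {\<one>\<^bsub>G\<^esub>} \<union> (carrier G - (\<Union>g \<in> carrier G. inv\<^bsub>G\<^esub> g <#\<^bsub>G\<^esub> (H #>\<^bsub>G\<^esub> g)))"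

text \<open>
  A square as seen by isotopisms: a set of cells together with its three partitions. The
  field \<open>letters\<close> holds, for each letter, the set of cells carrying that letter.
\<close>

record 'c square =
  cells :: "'c set"
  rows :: "'c set set"
  columns :: "'c set set"
  letters :: "'c set set"

definition isotopism :: "('c \<Rightarrow> 'd) \<Rightarrow> 'c square \<Rightarrow> 'd square \<Rightarrow> bool" where
  "isotopism f A B \<longleftrightarrow>
     bij_betw f (cells A) (cells B) \<and>
     image f ` rows A = rows B \<and>
     image f ` columns A = columns B \<and>
     image f ` letters A = letters B"

definition isotopic :: "'c square \<Rightarrow> 'd square \<Rightarrow> bool" where
  "isotopic A B \<longleftrightarrow> (\<exists>f. isotopism f A B)"

definition cayley_table :: "('a, 'b) monoid_scheme \<Rightarrow> ('a \<times> 'a) square" where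
  "cayley_table K = \<lparr>
     cells = carrier K \<times> carrier K,
     rows = (\<lambda>x. {x} \<times> carrier K) ` carrier K,
     columns = (\<lambda>y. carrier K \<times> {y}) ` carrier K,
     letters = (\<lambda>z. {(x, y) \<in> carrier K \<times> carrier K. x \<otimes>\<^bsub>K\<^esub> y = z}) ` carrier K\<rparr>"

definition grid :: "nat \<Rightarrow> (nat \<times> nat) set" where
  "grid n = {..<n} \<times> {..<n}"

text \<open>
  Latin squares of order \<open>n\<close> are extensional functions on the grid, so that counting
  functions is the same as counting squares.
\<close>

definition latin_square :: "nat \<Rightarrow> (nat \<times> nat \<Rightarrow> nat) \<Rightarrow> bool" where
  "latin_square n L \<longleftrightarrow>
     L \<in> grid n \<rightarrow>\<^sub>E {..<n} \<and>
     (\<forall>i<n. bij_betw (\<lambda>j. L (i, j)) {..<n} {..<n}) \<and>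
     (\<forall>j<n. bij_betw (\<lambda>i. L (i, j)) {..<n} {..<n})"

definition orthogonal_squares ::
    "nat \<Rightarrow> (nat \<times> nat \<Rightarrow> nat) \<Rightarrow> (nat \<times> nat \<Rightarrow> nat) \<Rightarrow> bool" where
  "orthogonal_squares n L M \<longleftrightarrow>
     bij_betw (\<lambda>c. (L c, M c)) (grid n) ({..<n} \<times> {..<n})"

definition mols :: "nat \<Rightarrow> (nat \<times> nat \<Rightarrow> nat) set \<Rightarrow> bool" where
  "mols n S \<longleftrightarrow>
     finite S \<and> (\<forall>L \<in> S. latin_square n L) \<and>
     (\<forall>L \<in> S. \<forall>M \<in> S. L \<noteq> M \<longrightarrow> orthogonal_squares n L M)"

definition row_partition :: "nat \<Rightarrow> (nat \<times> nat) set set" where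
  "row_partition n = (\<lambda>i. {i} \<times> {..<n}) ` {..<n}"

definition column_partition :: "nat \<Rightarrow> (nat \<times> nat) set set" where
  "column_partition n = (\<lambda>j. {..<n} \<times> {j}) ` {..<n}"

definition letter_partition :: "nat \<Rightarrow> (nat \<times> nat \<Rightarrow> nat) \<Rightarrow> (nat \<times> nat) set set" where
  "letter_partition n L = (\<lambda>a. {c \<in> grid n. L c = a}) ` {..<n}"

definition mols_partitions :: "nat \<Rightarrow> (nat \<times> nat \<Rightarrow> nat) set \<Rightarrow> (nat \<times> nat) set set set" where
  "mols_partitions n S = {row_partition n, column_partition n} \<union> letter_partition n ` S"

text \<open>
  For \<open>n \<ge> 2\<close> the \<open>card S + 2\<close> partitions of a set \<open>S\<close> of mutually orthogonal Latin squares are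
  distinct; for \<open>n = 1\<close> they all coincide.
  Each choice of three distinct partitions is taken with all six assignments of the roles of
  rows, columns and letters, so no convention for assigning these roles is needed.
\<close>

definition determined_squares :: "nat \<Rightarrow> (nat \<times> nat \<Rightarrow> nat) set \<Rightarrow> (nat \<times> nat) square set" where
  "determined_squares n S =
     {\<lparr>cells = grid n, rows = P, columns = Q, letters = R\<rparr> | P Q R.
        P \<in> mols_partitions n S \<and> Q \<in> mols_partitions n S \<and> R \<in> mols_partitions n S \<and>
        P \<noteq> Q \<and> P \<noteq> R \<and> Q \<noteq> R}"

text \<open>
  Only finite groups can occur below, and each of them has an isomorphic copy whose elements
  are natural numbers.
\<close>

definition mogs :: "nat \<Rightarrow> (nat \<times> nat \<Rightarrow> nat) set \<Rightarrow> bool" where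
  "mogs n S \<longleftrightarrow>
     mols n S \<and>
     (\<forall>A \<in> determined_squares n S. \<exists>K :: nat monoid. group K \<and> isotopic A (cayley_table K))"

end

theory Submission
  imports Defs
begin

text \<open>
  Conjugation makes \<open>H\<close> a group of fixed-point-free automorphisms of \<open>N\<close>, and the squares are
  \<open>(x, y) \<mapsto> h x h\<^sup>-\<^sup>1 y\<close> for \<open>h\<close> in \<open>H\<close>. Since \<open>N\<close> is abelian, the maps giving the row, the
  column and the letters of a cell are homomorphisms from \<open>N \<times> N\<close> to \<open>N\<close>, and fixed-point-freeness
  says that any two of them have kernels meeting trivially. Given three such homomorphisms, one is
  a product of bijective functions of the other two, which is an isotopism to the Cayley table.
\<close>

section \<open>Frobenius kernels with commuting elements\<close>

lemma (in group) inv_cancel: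
  assumes "g \<in> carrier G" and "x \<in> carrier G"
  shows "inv g \<otimes> (g \<otimes> x) = x" and "g \<otimes> (inv g \<otimes> x) = x"
  using assms by (simp_all add: m_assoc[symmetric])

lemma (in group) conj_eq_one_iff:
  assumes "g \<in> carrier G" and "x \<in> carrier G"
  shows "g \<otimes> x \<otimes> inv g = \<one> \<longleftrightarrow> x = \<one>"
  using assms by (simp add: inv_solve_right')

text \<open>If \<open>g\<close> were outside \<open>H\<close>, the conjugate of \<open>h\<close>
  would lie both in \<open>H\<close> and in the conjugate of \<open>H\<close> by \<open>g\<close>,
  hence be the identity, and then so would \<open>h\<close>. Later \<open>g\<close> is a kernel
  element, which is thereby forced into \<open>H\<close>.\<close>

lemma frobenius_complement_mem:
  fixes G (structure)
  assumes "frobenius_complement G H" and "g \<in> carrier G" and "h \<in> H" and "h \<noteq> \<one>"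
    and "inv g \<otimes> h \<otimes> g \<in> H"
  shows "g \<in> H"
proof (rule ccontr)
  interpret group G using assms(1) by (simp add: frobenius_complement_def)
  have H: "subgroup H G" using assms(1) by (simp add: frobenius_complement_def)
  have hc: "h \<in> carrier G" using H assms(3) by (rule subgroup.mem_carrier)
  assume "g \<notin> H"
  then have int: "H \<inter> (inv g <# (H #> g)) = {\<one>}"
    using assms(1,2) by (simp add: frobenius_complement_def)
  have "inv g \<otimes> h \<otimes> g = inv g \<otimes> (h \<otimes> g)"
    using assms(2) hc by (simp add: m_assoc)
  moreover have "\<dots> \<in> inv g <# (H #> g)"
    using assms(3) by (auto simp: l_coset_def r_coset_def)
  ultimately have "inv g \<otimes> (h \<otimes> g) = \<one>" using int assms(5) by auto
  then have "h \<otimes> g = g" using assms(2) hc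
    by (simp add: inv_solve_left')
  then show False using assms(2,4) hc by simp
qed

text \<open>An element lies in the conjugate of \<open>H\<close> by \<open>g\<close> exactly when
  conjugating it back by \<open>g\<close> lands in \<open>H\<close>. The implication ends in
  \<open>x = \<one>\<close> because the identity belongs to the kernel and to every conjugate
  alike.\<close>

lemma (in group) mem_frobenius_kernel_iff:
  assumes "subgroup H G"
  shows "x \<in> frobenius_kernel G H \<longleftrightarrow>
    x \<in> carrier G \<and> (\<forall>g\<in>carrier G. g \<otimes> x \<otimes> inv g \<in> H \<longrightarrow> x = \<one>)"
proof -
  have conj: "x \<in> inv g <# (H #> g) \<longleftrightarrow> g \<otimes> x \<otimes> inv g \<in> H"
    if "x \<in> carrier G" "g \<in> carrier G" for g
  proof
    assume "x \<in> inv g <# (H #> g)"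
    then obtain h where h: "h \<in> H" "x = inv g \<otimes> (h \<otimes> g)"
      by (auto simp: l_coset_def r_coset_def)
    have hc: "h \<in> carrier G" using assms h(1) by (rule subgroup.mem_carrier)
    have "g \<otimes> x = h \<otimes> g" using h(2) hc that by (simp add: m_assoc[symmetric])
    then show "g \<otimes> x \<otimes> inv g \<in> H" using h hc that by (simp add: m_assoc)
  next
    assume *: "g \<otimes> x \<otimes> inv g \<in> H"
    have "x = inv g \<otimes> ((g \<otimes> x \<otimes> inv g) \<otimes> g)"
      using that by (simp add: m_assoc inv_cancel)
    then show "x \<in> inv g <# (H #> g)" using * by (auto simp: l_coset_def r_coset_def)
  qed
  show ?thesis
    unfolding frobenius_kernel_def using conj by blast
qed

lemma (in group) frobenius_kernel_conj:
  assumes "subgroup H G" and "x \<in> frobenius_kernel G H" and "g \<in> carrier G"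
  shows "g \<otimes> x \<otimes> inv g \<in> frobenius_kernel G H"
proof -
  have x: "x \<in> carrier G" and *: "\<And>k. k \<in> carrier G \<Longrightarrow> k \<otimes> x \<otimes> inv k \<in> H \<Longrightarrow> x = \<one>"
    using assms mem_frobenius_kernel_iff by auto
  have "g \<otimes> x \<otimes> inv g = \<one>" if "k \<in> carrier G" "k \<otimes> (g \<otimes> x \<otimes> inv g) \<otimes> inv k \<in> H" for k
  proof -
    have "(k \<otimes> g) \<otimes> x \<otimes> inv (k \<otimes> g) = k \<otimes> (g \<otimes> x \<otimes> inv g) \<otimes> inv k"
      using x that(1) assms(3) by (simp add: m_assoc inv_mult_group)
    then have "x = \<one>" using *[of "k \<otimes> g"] that assms(3) by simp
    then show ?thesis using assms(3) by simp
  qed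
  moreover have "g \<otimes> x \<otimes> inv g \<in> carrier G" using x assms(3) by simp
  ultimately show ?thesis
    using mem_frobenius_kernel_iff[OF assms(1), of "g \<otimes> x \<otimes> inv g"] by blast
qed

lemma frobenius_kernel_Int_complement:
  assumes "frobenius_complement G H" and "x \<in> frobenius_kernel G H" and "x \<in> H"
  shows "x = \<one>\<^bsub>G\<^esub>"
proof -
  interpret group G using assms(1) by (simp add: frobenius_complement_def)
  have H: "subgroup H G" using assms(1) by (simp add: frobenius_complement_def)
  then have x: "x \<in> carrier G" using assms(3) by (rule subgroup.mem_carrier)
  have "\<one>\<^bsub>G\<^esub> \<otimes>\<^bsub>G\<^esub> x \<otimes>\<^bsub>G\<^esub> inv\<^bsub>G\<^esub> \<one>\<^bsub>G\<^esub> \<in> H" using x assms(3) by simp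
  then show ?thesis using assms(2) mem_frobenius_kernel_iff[OF H, of x] one_closed by blast
qed

text \<open>
  A conjugate of \<open>H\<close> by \<open>g\<close> depends only on the coset \<open>H g\<close>, so the conjugates contain at most
  \<open>[G : H] (|H| - 1)\<close> non-identity elements, fewer than \<open>|G| - 1\<close>.
\<close>
lemma frobenius_kernel_nontrivial:
  fixes G (structure)
  assumes "frobenius_complement G H"
  shows "frobenius_kernel G H \<noteq> {\<one>}"
proof
  assume triv: "frobenius_kernel G H = {\<one>}"
  interpret group G using assms by (simp add: frobenius_complement_def)
  have H: "subgroup H G" and fin: "finite (carrier G)" and neq: "H \<noteq> carrier G"
    using assms by (auto simp: frobenius_complement_def)
  interpret H: subgroup H G by (rule H)
  have finH: "finite H" using fin H.subset finite_subset by blast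
  have "\<exists>r\<in>carrier G. C = H #> r" if "C \<in> rcosets H" for C
    using that by (auto simp: RCOSETS_def)
  \<comment> \<open>One representative per coset, so that \<open>F C\<close> lists the non-identity
    elements of the single conjugate of \<open>H\<close> belonging to \<open>C\<close>.\<close>
  then obtain r where r: "\<And>C. C \<in> rcosets H \<Longrightarrow> r C \<in> carrier G \<and> C = H #> r C" by metis
  define F where "F C = (\<lambda>h. inv (r C) \<otimes> h \<otimes> r C) ` (H - {\<one>})" for C
  have finR: "finite (rcosets H)"
    using fin by (auto simp: RCOSETS_def)
  have "carrier G - {\<one>} \<subseteq> (\<Union>C\<in>rcosets H. F C)"
  proof
    fix x assume x: "x \<in> carrier G - {\<one>}"
    then obtain g where g: "g \<in> carrier G" "g \<otimes> x \<otimes> inv g \<in> H"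
      using triv mem_frobenius_kernel_iff[OF H, of x] by auto
    define C where "C = H #> g"
    have C: "C \<in> rcosets H" using g by (auto simp: C_def RCOSETS_def)
    have rC: "r C \<in> carrier G" and "C = H #> r C" using r[OF C] by auto
    \<comment> \<open>The conjugating element \<open>g\<close> need not be the chosen
      representative. The two differ by some \<open>k\<close> in \<open>H\<close>, and conjugating
      by \<open>k\<close> does not leave \<open>H\<close>.\<close>
    then have "r C \<in> H #> g" using rcos_self[OF rC H] C_def by simp
    then obtain k where k: "k \<in> H" "r C = k \<otimes> g" by (auto simp: r_coset_def)
    define h where "h = k \<otimes> (g \<otimes> x \<otimes> inv g) \<otimes> inv k"
    have hH: "h \<in> H" using k g by (simp add: h_def)
    have "h = r C \<otimes> x \<otimes> inv (r C)"
      using k g x by (simp add: h_def m_assoc inv_mult_group)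
    then have xh: "x = inv (r C) \<otimes> h \<otimes> r C"
      using x rC by (simp add: m_assoc inv_cancel)
    then have "h \<noteq> \<one>" using x rC by auto
    then show "x \<in> (\<Union>C\<in>rcosets H. F C)" using xh hH C by (auto simp: F_def)
  qed
  then have "card (carrier G - {\<one>}) \<le> card (\<Union>C\<in>rcosets H. F C)"
    using finR finH by (intro card_mono) (auto simp: F_def)
  also have "\<dots> \<le> (\<Sum>C\<in>rcosets H. card (F C))"
    using finR by (rule card_UN_le)
  also have "\<dots> \<le> (\<Sum>C\<in>rcosets H. card H - 1)"
  proof (rule sum_mono)
    fix C
    have "card (F C) \<le> card (H - {\<one>})" unfolding F_def using finH by (intro card_image_le) auto
    then show "card (F C) \<le> card H - 1" using finH by simp
  qed
  finally have le: "card (carrier G) - 1 \<le> card (rcosets H) * (card H - 1)"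
    using fin by simp
  have lag: "card (rcosets H) * card H = card (carrier G)"
    using lagrange[OF H] by (simp add: order_def)
  have pos: "card H > 0" "card (carrier G) > 0" 
    using finH fin H.one_closed one_closed unfolding card_gt_0_iff by blast+
  \<comment> \<open>By Lagrange the bound reads |G| - 1 \<le> |G| - [G : H]. So the index is at most
    1, contradicting that \<open>H\<close> is proper.\<close>
  have "card (rcosets H) * (card H - 1) + card (rcosets H) = card (carrier G)"
    unfolding lag[symmetric] using pos(1) by (metis Suc_pred' add.commute mult_Suc_right)
  then have "card (rcosets H) \<le> 1" using le pos by linarith
  then have "card (rcosets H) * card H \<le> 1 * card H" by (rule mult_le_mono1)
  then have "card (carrier G) \<le> card H" unfolding lag by simp
  then show False using neq card_seteq[OF fin H.subset] by blast
qed

text \<open>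
  Frobenius' theorem is easy here: a non-identity element of \<open>H\<close> that is a product of two elements
  of the kernel commutes with the whole kernel, which forces the kernel into \<open>H\<close>.
\<close>
lemma subgroup_frobenius_kernel:
  fixes G (structure)
  assumes fc: "frobenius_complement G H"
    and comm: "\<And>x y. x \<in> frobenius_kernel G H \<Longrightarrow> y \<in> frobenius_kernel G H \<Longrightarrow> x \<otimes> y = y \<otimes> x"
  shows "subgroup (frobenius_kernel G H) G"
proof -
  interpret group G using fc by (simp add: frobenius_complement_def)
  have H: "subgroup H G" using fc by (simp add: frobenius_complement_def)
  interpret H: subgroup H G by (rule H)
  note mem = mem_frobenius_kernel_iff[OF H]
  let ?N = "frobenius_kernel G H"
  have one: "\<one> \<in> ?N" by (simp add: frobenius_kernel_def)
  have sub: "?N \<subseteq> carrier G" using mem by auto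
  have prod: "a \<otimes> b = \<one>" if a: "a \<in> ?N" and b: "b \<in> ?N" and ab: "a \<otimes> b \<in> H" for a b
  proof (rule ccontr)
    assume ne: "a \<otimes> b \<noteq> \<one>"
    have "z = \<one>" if z: "z \<in> ?N" for z
    proof -
      have c: "a \<in> carrier G" "b \<in> carrier G" "z \<in> carrier G" using a b z sub by auto
      have "a \<otimes> b \<otimes> z = a \<otimes> z \<otimes> b" using c by (simp add: m_assoc comm[OF b z])
      also have "\<dots> = z \<otimes> (a \<otimes> b)" using c by (simp add: m_assoc comm[OF a z])
      finally have "inv z \<otimes> (a \<otimes> b \<otimes> z) = a \<otimes> b" using c by (simp add: inv_cancel)
      then have "inv z \<otimes> (a \<otimes> b) \<otimes> z = a \<otimes> b" using c by (simp add: m_assoc)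
      then have "z \<in> H" using frobenius_complement_mem[OF fc c(3) ab ne] ab by simp
      then show ?thesis by (rule frobenius_kernel_Int_complement[OF fc z])
    qed
    then show False using one frobenius_kernel_nontrivial[OF fc] by blast
  qed
  show ?thesis
  proof (rule subgroupI)
    show "?N \<subseteq> carrier G" by (rule sub)
    show "?N \<noteq> {}" using one by blast
  next
    fix a assume a: "a \<in> ?N"
    then have c: "a \<in> carrier G" using sub by auto
    \<comment> \<open>\<open>H\<close> is closed under inverses, so a conjugate of
      \<open>inv a\<close> in \<open>H\<close> yields a conjugate of \<open>a\<close> in
      \<open>H\<close>.\<close>
    have "inv a = \<one>" if "g \<in> carrier G" "g \<otimes> inv a \<otimes> inv g \<in> H" for g
    proof -
      have "inv (g \<otimes> inv a \<otimes> inv g) = g \<otimes> a \<otimes> inv g"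
        using that(1) c by (simp add: m_assoc inv_mult_group)
      then have "g \<otimes> a \<otimes> inv g \<in> H" using H.m_inv_closed[OF that(2)] by simp
      then have "a = \<one>" using that(1) a mem[of a] by blast
      then show ?thesis by simp
    qed
    then show "inv a \<in> ?N" using c mem[of "inv a"] inv_closed[OF c] by blast
  next
    fix a b assume a: "a \<in> ?N" and b: "b \<in> ?N"
    have c: "a \<in> carrier G" "b \<in> carrier G" using a b sub by auto
    \<comment> \<open>The claim \<open>prod\<close> concerns only \<open>H\<close> itself. It
      reaches every conjugate because a conjugate of a product is the product of the conjugates,
      which are again kernel elements.\<close>
    have "a \<otimes> b = \<one>" if g: "g \<in> carrier G" "g \<otimes> (a \<otimes> b) \<otimes> inv g \<in> H" for g
    proof -
      have eq: "g \<otimes> (a \<otimes> b) \<otimes> inv g = (g \<otimes> a \<otimes> inv g) \<otimes> (g \<otimes> b \<otimes> inv g)"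
        using g(1) c by (simp add: m_assoc inv_cancel)
      have "g \<otimes> (a \<otimes> b) \<otimes> inv g = \<one>"
        unfolding eq by (intro prod frobenius_kernel_conj H a b g(1) g(2)[unfolded eq])
      then show ?thesis using g(1) c by (simp add: conj_eq_one_iff)
    qed
    then show "a \<otimes> b \<in> ?N" using mem[of "a \<otimes> b"] m_closed[OF c] by blast
  qed
qed

text \<open>This is the fixed-point-freeness of the action of \<open>H\<close>. If \<open>h\<close>
  and \<open>k\<close> agree on \<open>x\<close>, then \<open>inv k \<otimes> h\<close> is a
  non-identity element of \<open>H\<close> commuting with \<open>x\<close>. So conjugation by
  \<open>x\<close> keeps it in \<open>H\<close>, which puts \<open>x\<close> into \<open>H\<close>,
  and \<open>H\<close> meets the kernel trivially.\<close>

lemma frobenius_kernel_conj_eq: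
  fixes G (structure)
  assumes fc: "frobenius_complement G H" and x: "x \<in> frobenius_kernel G H"
    and h: "h \<in> H" and k: "k \<in> H" and ne: "h \<noteq> k"
    and eq: "h \<otimes> x \<otimes> inv h = k \<otimes> x \<otimes> inv k"
  shows "x = \<one>"
proof -
  interpret group G using fc by (simp add: frobenius_complement_def)
  have H: "subgroup H G" using fc by (simp add: frobenius_complement_def)
  interpret H: subgroup H G by (rule H)
  have c: "x \<in> carrier G" "h \<in> carrier G" "k \<in> carrier G"
    using x h k mem_frobenius_kernel_iff[OF H] by auto
  define m where "m = inv k \<otimes> h"
  have m: "m \<in> H" "m \<in> carrier G" using h k by (auto simp: m_def)
  have "m \<noteq> \<one>"
    unfolding m_def using ne c by (auto simp: inv_solve_left')
  moreover have "m \<otimes> x = x \<otimes> m"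
  proof -
    have "h \<otimes> x = k \<otimes> x \<otimes> inv k \<otimes> h" using eq c by (simp add: inv_solve_right')
    then have "m \<otimes> x = inv k \<otimes> (k \<otimes> (x \<otimes> m))" using c by (simp add: m_def m_assoc)
    then show ?thesis using c m by (simp add: inv_cancel)
  qed
  then have "inv x \<otimes> m \<otimes> x = m" using c m by (simp add: m_assoc inv_cancel)
  ultimately have "x \<in> H" using frobenius_complement_mem[OF fc c(1) m(1)] m(1) by simp
  then show ?thesis by (rule frobenius_kernel_Int_complement[OF fc x])
qed

section \<open>Isotopisms of squares of fibres\<close>

text \<open>Rows, columns and letters, on the grid and in Cayley tables, all take this form, so one
  lemma about relabelling values serves all three.\<close>

definition fibres :: "'c set \<Rightarrow> ('c \<Rightarrow> 'x) \<Rightarrow> 'x set \<Rightarrow> 'c set set" where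
  "fibres C p X = (\<lambda>a. {c \<in> C. p c = a}) ` X"

text \<open>Since \<open>s\<close> is injective on \<open>X\<close>, a cell has value
  \<open>a\<close> under \<open>p\<close> exactly when its image has value \<open>s a\<close> under
  \<open>q\<close>. An isotopism thus reduces to a bijection of cells together with bijective
  relabellings of rows, columns and letters.\<close>

lemma image_fibres:
  assumes g: "bij_betw g C D" and s: "bij_betw s X Y" and p: "p \<in> C \<rightarrow> X"
    and eq: "\<And>c. c \<in> C \<Longrightarrow> q (g c) = s (p c)"
  shows "image g ` fibres C p X = fibres D q Y"
proof -
  have "g ` {c \<in> C. p c = a} = {d \<in> D. q d = s a}" if "a \<in> X" for a
  proof -
    have "p c = a \<longleftrightarrow> q (g c) = s a" if "c \<in> C" for c
      using that \<open>a \<in> X\<close> p eq[OF that] inj_on_eq_iff[of s X "p c" a] s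
      by (auto simp: bij_betw_def)
    then have "g ` {c \<in> C. p c = a} = g ` {c \<in> C. q (g c) = s a}"
      by (metis (mono_tags, lifting) Collect_cong)
    also have "\<dots> = {d \<in> D. q d = s a}" using g by (auto simp: bij_betw_def)
    finally show ?thesis .
  qed
  then have "image g ` fibres C p X = (\<lambda>a. {d \<in> D. q d = s a}) ` X"
    by (auto simp: fibres_def image_image)
  also have "\<dots> = fibres D q (s ` X)" by (auto simp: fibres_def)
  finally show ?thesis using s by (simp add: bij_betw_def)
qed

text \<open>Renaming the values bijectively does not move any cell. This passes between numbers and
  group elements as labels.\<close>

lemma fibres_cong:
  assumes "bij_betw s X Y" and "p \<in> C \<rightarrow> X" and "\<And>c. c \<in> C \<Longrightarrow> q c = s (p c)"
  shows "fibres C p X = fibres C q Y"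
  using image_fibres[of id C C s X Y p q] assms by simp

lemma cayley_table_fibres:
  "cayley_table K = \<lparr>cells = carrier K \<times> carrier K,
     rows = fibres (carrier K \<times> carrier K) fst (carrier K),
     columns = fibres (carrier K \<times> carrier K) snd (carrier K),
     letters = fibres (carrier K \<times> carrier K) (\<lambda>(x, y). x \<otimes>\<^bsub>K\<^esub> y) (carrier K)\<rparr>"
  unfolding cayley_table_def fibres_def
  by (auto intro!: image_cong)

lemma isotopic_trans:
  assumes "isotopic A B" and "isotopic B C"
  shows "isotopic A C"
proof -
  obtain f g where f: "isotopism f A B" and g: "isotopism g B C"
    using assms by (auto simp: isotopic_def)
  have comp: "image (g \<circ> f) ` S = image g ` (image f ` S)" for S :: "'a set set"
    by (simp only: image_image image_comp o_def)
  have "bij_betw (g \<circ> f) (cells A) (cells C)"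
    using f g unfolding isotopism_def by (elim conjE) (rule bij_betw_trans)
  then have "isotopism (g \<circ> f) A C"
    using f g unfolding isotopism_def comp by simp
  then show ?thesis by (auto simp: isotopic_def)
qed

lemma isotopic_cayley_table_iso:
  assumes "group M" and "f \<in> iso M K"
  shows "isotopic (cayley_table M) (cayley_table K)"
proof -
  interpret group M by fact
  have f: "bij_betw f (carrier M) (carrier K)"
    and hom: "\<And>x y. x \<in> carrier M \<Longrightarrow> y \<in> carrier M \<Longrightarrow> f (x \<otimes>\<^bsub>M\<^esub> y) = f x \<otimes>\<^bsub>K\<^esub> f y"
    using assms(2) by (auto simp: iso_def hom_def)
  have ff: "bij_betw (map_prod f f) (carrier M \<times> carrier M) (carrier K \<times> carrier K)"
    using f f by (rule bij_betw_map_prod)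
  have "isotopism (map_prod f f) (cayley_table M) (cayley_table K)"
    unfolding isotopism_def cayley_table_fibres square.simps
    by (intro conjI ff image_fibres[OF ff f]) (auto simp: hom)
  then show ?thesis by (auto simp: isotopic_def)
qed

text \<open>Transport of structure along an enumeration of the carrier. It supplies the groups on
  natural numbers that \<open>mogs\<close> asks for.\<close>

lemma finite_group_iso_nat:
  assumes "group M" and "finite (carrier M)"
  shows "\<exists>(K :: nat monoid) f. group K \<and> f \<in> iso M K"
proof -
  interpret group M by fact
  obtain e where e: "bij_betw e (carrier M) {0..<card (carrier M)}"
    using assms(2) ex_bij_betw_finite_nat by blast
  define d where "d = inv_into (carrier M) e"
  have de: "d (e x) = x" if "x \<in> carrier M" for x
    using e that by (simp add: d_def bij_betw_inv_into_left)
  define K :: "nat monoid" where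
    "K = \<lparr>carrier = {0..<card (carrier M)}, mult = (\<lambda>i j. e (d i \<otimes>\<^bsub>M\<^esub> d j)), one = e \<one>\<^bsub>M\<^esub>\<rparr>"
  have iso: "e \<in> iso M K"
    using e bij_betwE[OF e] by (simp add: iso_def hom_def K_def de)
  have "group (K\<lparr>one := e \<one>\<^bsub>M\<^esub>\<rparr>)" using iso by (rule iso_imp_img_group)
  moreover have "K\<lparr>one := e \<one>\<^bsub>M\<^esub>\<rparr> = K" by (simp add: K_def)
  ultimately have "group K" by simp
  then show ?thesis using iso by blast
qed

section \<open>Orthogonal homomorphisms\<close>

text \<open>This also covers the Latin property: if \<open>p\<close> gives rows and \<open>q\<close>
  letters, it says that each letter occurs exactly once in each row.\<close>

definition orthogonal_maps ::
    "('c, 'm) monoid_scheme \<Rightarrow> ('a, 'b) monoid_scheme \<Rightarrow> ('c \<Rightarrow> 'a) \<Rightarrow> ('c \<Rightarrow> 'a) \<Rightarrow> bool" where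
  "orthogonal_maps A M p q \<longleftrightarrow>
     bij_betw (\<lambda>c. (p c, q c)) (carrier A) (carrier M \<times> carrier M)"

lemma orthogonal_maps_sym: "orthogonal_maps A M p q \<Longrightarrow> orthogonal_maps A M q p"
proof -
  assume "orthogonal_maps A M p q"
  moreover have "bij_betw prod.swap (carrier M \<times> carrier M) (carrier M \<times> carrier M)"
    by (auto simp: bij_betw_def inj_on_def)
  ultimately have "bij_betw (prod.swap \<circ> (\<lambda>c. (p c, q c))) (carrier A) (carrier M \<times> carrier M)"
    unfolding orthogonal_maps_def by (rule bij_betw_trans)
  then show ?thesis by (simp add: orthogonal_maps_def comp_def)
qed

lemma orthogonal_maps_inj:
  assumes "orthogonal_maps A M p q" and "c \<in> carrier A" and "d \<in> carrier A"
    and "p c = p d" and "q c = q d"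
  shows "c = d"
  using assms by (auto simp: orthogonal_maps_def bij_betw_def dest: inj_onD)

lemma orthogonal_maps_surj:
  assumes "orthogonal_maps A M p q" and "x \<in> carrier M" and "y \<in> carrier M"
  shows "\<exists>c\<in>carrier A. p c = x \<and> q c = y"
proof -
  have "(x, y) \<in> (\<lambda>c. (p c, q c)) ` carrier A"
    using assms by (simp add: orthogonal_maps_def bij_betw_def)
  then show ?thesis by auto
qed

text \<open>The pair of \<open>p\<close> and \<open>q\<close> is a homomorphism into the direct
  square of \<open>M\<close>. A trivial common kernel makes it injective, and equality of the finite
  cardinalities then makes it onto.\<close>

lemma orthogonal_mapsI:
  assumes A: "group A" and M: "group M" and fin: "finite (carrier A)" "finite (carrier M)"
    and card: "card (carrier A) = card (carrier M) * card (carrier M)"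
    and p: "p \<in> hom A M" and q: "q \<in> hom A M"
    and ker: "\<And>c. c \<in> carrier A \<Longrightarrow> p c = \<one>\<^bsub>M\<^esub> \<Longrightarrow> q c = \<one>\<^bsub>M\<^esub> \<Longrightarrow> c = \<one>\<^bsub>A\<^esub>"
  shows "orthogonal_maps A M p q"
proof -
  have "(\<lambda>c. (p c, q c)) \<in> hom A (M \<times>\<times> M)"
    using p q by (auto simp: hom_def DirProd_def)
  then interpret group_hom A "M \<times>\<times> M" "\<lambda>c. (p c, q c)"
    using A M by (auto simp: group_hom_def group_hom_axioms_def intro: DirProd_group)
  have inj: "inj_on (\<lambda>c. (p c, q c)) (carrier A)"
    using ker by (auto simp: inj_on_one_iff)
  moreover have "(\<lambda>c. (p c, q c)) ` carrier A = carrier M \<times> carrier M"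
  proof (rule card_subset_eq)
    show "finite (carrier M \<times> carrier M)" using fin by simp
    show "(\<lambda>c. (p c, q c)) ` carrier A \<subseteq> carrier M \<times> carrier M"
      using p q by (auto simp: hom_def)
    show "card ((\<lambda>c. (p c, q c)) ` carrier A) = card (carrier M \<times> carrier M)"
      using inj card by (simp add: card_image card_cartesian_product)
  qed
  ultimately show ?thesis by (simp add: orthogonal_maps_def bij_betw_def)
qed

text \<open>
  If \<open>c = c\<^sub>1 c\<^sub>2\<close> with \<open>c\<^sub>1\<close> in the kernel of \<open>q\<close> and \<open>c\<^sub>2\<close> in the kernel of \<open>p\<close>, then
  \<open>r c = r c\<^sub>1 \<cdot> r c\<^sub>2\<close>, where \<open>r c\<^sub>1\<close> and \<open>r c\<^sub>2\<close> are bijective functions of \<open>p c\<close> and \<open>q c\<close>.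
\<close>
lemma orthogonal_maps_isotopic_cayley_table:
  fixes A :: "('c, 'm) monoid_scheme" and M :: "('a, 'b) monoid_scheme"
  assumes A: "group A" and M: "group M"
    and p: "p \<in> hom A M" and q: "q \<in> hom A M" and r: "r \<in> hom A M"
    and pq: "orthogonal_maps A M p q" and pr: "orthogonal_maps A M p r"
    and qr: "orthogonal_maps A M q r"
  shows "isotopic \<lparr>cells = carrier A, rows = fibres (carrier A) p (carrier M),
      columns = fibres (carrier A) q (carrier M), letters = fibres (carrier A) r (carrier M)\<rparr>
    (cayley_table M)"
proof -
  interpret A: group A by fact
  interpret M: group M by fact
  have pc: "p \<in> carrier A \<rightarrow> carrier M" and qc: "q \<in> carrier A \<rightarrow> carrier M"
    and rc: "r \<in> carrier A \<rightarrow> carrier M" using p q r by (auto simp: hom_def)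
  \<comment> \<open>\<open>t x y\<close> is the unique cell in row \<open>x\<close> and column
    \<open>y\<close>.\<close>
  obtain t where t: "\<And>x y. x \<in> carrier M \<Longrightarrow> y \<in> carrier M \<Longrightarrow>
      t x y \<in> carrier A \<and> p (t x y) = x \<and> q (t x y) = y"
    using orthogonal_maps_surj[OF pq] by metis
  define \<alpha> where "\<alpha> x = r (t x \<one>\<^bsub>M\<^esub>)" for x
  define \<beta> where "\<beta> y = r (t \<one>\<^bsub>M\<^esub> y)" for y
  have split: "r c = \<alpha> (p c) \<otimes>\<^bsub>M\<^esub> \<beta> (q c)" if c: "c \<in> carrier A" for c
  proof -
    have pcc: "p c \<in> carrier M" and qcc: "q c \<in> carrier M" using c pc qc by auto
    let ?a = "t (p c) \<one>\<^bsub>M\<^esub>" and ?b = "t \<one>\<^bsub>M\<^esub> (q c)"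
    have a: "?a \<in> carrier A" "p ?a = p c" "q ?a = \<one>\<^bsub>M\<^esub>" using t[OF pcc M.one_closed] by auto
    have b: "?b \<in> carrier A" "p ?b = \<one>\<^bsub>M\<^esub>" "q ?b = q c" using t[OF M.one_closed qcc] by auto
    have "c = ?a \<otimes>\<^bsub>A\<^esub> ?b"
      by (rule orthogonal_maps_inj[OF pq c])
        (use a b pcc qcc hom_mult[OF p a(1) b(1)] hom_mult[OF q a(1) b(1)] in auto)
    then have "r c = r (?a \<otimes>\<^bsub>A\<^esub> ?b)" by simp
    then show ?thesis using hom_mult[OF r a(1) b(1)] by (simp add: \<alpha>_def \<beta>_def)
  qed
  \<comment> \<open>\<open>\<alpha>\<close> lists the letters along the column where
    \<open>q\<close> is the identity, so the orthogonality of \<open>q\<close> and \<open>r\<close>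
    makes it a bijection. Symmetrically, \<open>\<beta>\<close> lists them along the row where
    \<open>p\<close> is the identity.\<close>
  have \<alpha>: "bij_betw \<alpha> (carrier M) (carrier M)"
  proof (rule bij_betw_imageI)
    show "inj_on \<alpha> (carrier M)"
    proof (rule inj_onI)
      fix x y assume xy: "x \<in> carrier M" "y \<in> carrier M" "\<alpha> x = \<alpha> y"
      note tt = t[OF xy(1) M.one_closed] t[OF xy(2) M.one_closed]
      have "t x \<one>\<^bsub>M\<^esub> = t y \<one>\<^bsub>M\<^esub>"
        by (rule orthogonal_maps_inj[OF qr]) (use tt xy(3) in \<open>auto simp: \<alpha>_def\<close>)
      then show "x = y" using tt by metis
    qed
    show "\<alpha> ` carrier M = carrier M"
    proof
      show "\<alpha> ` carrier M \<subseteq> carrier M" using t rc by (auto simp: \<alpha>_def)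
      show "carrier M \<subseteq> \<alpha> ` carrier M"
      proof
        fix z assume "z \<in> carrier M"
        then obtain c where c: "c \<in> carrier A" "q c = \<one>\<^bsub>M\<^esub>" "r c = z"
          using orthogonal_maps_surj[OF qr M.one_closed] by blast
        have pcc: "p c \<in> carrier M" using c pc by auto
        have "t (p c) \<one>\<^bsub>M\<^esub> = c"
          by (rule orthogonal_maps_inj[OF pq]) (use t[OF pcc M.one_closed] c in auto)
        then show "z \<in> \<alpha> ` carrier M" using c pcc by (force simp: \<alpha>_def)
      qed
    qed
  qed
  have \<beta>: "bij_betw \<beta> (carrier M) (carrier M)"
  proof (rule bij_betw_imageI)
    show "inj_on \<beta> (carrier M)"
    proof (rule inj_onI)
      fix x y assume xy: "x \<in> carrier M" "y \<in> carrier M" "\<beta> x = \<beta> y"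
      note tt = t[OF M.one_closed xy(1)] t[OF M.one_closed xy(2)]
      have "t \<one>\<^bsub>M\<^esub> x = t \<one>\<^bsub>M\<^esub> y"
        by (rule orthogonal_maps_inj[OF pr]) (use tt xy(3) in \<open>auto simp: \<beta>_def\<close>)
      then show "x = y" using tt by metis
    qed
    show "\<beta> ` carrier M = carrier M"
    proof
      show "\<beta> ` carrier M \<subseteq> carrier M" using t rc by (auto simp: \<beta>_def)
      show "carrier M \<subseteq> \<beta> ` carrier M"
      proof
        fix z assume "z \<in> carrier M"
        then obtain c where c: "c \<in> carrier A" "p c = \<one>\<^bsub>M\<^esub>" "r c = z"
          using orthogonal_maps_surj[OF pr M.one_closed] by blast
        have qcc: "q c \<in> carrier M" using c qc by auto
        have "t \<one>\<^bsub>M\<^esub> (q c) = c"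
          by (rule orthogonal_maps_inj[OF pq]) (use t[OF M.one_closed qcc] c in auto)
        then show "z \<in> \<beta> ` carrier M" using c qcc by (force simp: \<beta>_def)
      qed
    qed
  qed
  \<comment> \<open>Rows are relabelled by \<open>\<alpha>\<close> and columns by
    \<open>\<beta>\<close>. By \<open>split\<close> the table entry at \<open>g c\<close> is
    \<open>r c\<close>, so letters keep their names.\<close>
  define g where "g = map_prod \<alpha> \<beta> \<circ> (\<lambda>c. (p c, q c))"
  have g: "bij_betw g (carrier A) (carrier M \<times> carrier M)"
    unfolding g_def
    using pq bij_betw_map_prod[OF \<alpha> \<beta>] by (auto simp: orthogonal_maps_def intro: bij_betw_trans)
  have id: "bij_betw id (carrier M) (carrier M)" by simp
  have "isotopism g \<lparr>cells = carrier A, rows = fibres (carrier A) p (carrier M),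
      columns = fibres (carrier A) q (carrier M), letters = fibres (carrier A) r (carrier M)\<rparr>
    (cayley_table M)"
    unfolding isotopism_def cayley_table_fibres square.simps
    by (intro conjI g image_fibres[OF g \<alpha> pc] image_fibres[OF g \<beta> qc] image_fibres[OF g id rc])
      (auto simp: g_def split)
  then show ?thesis by (auto simp: isotopic_def)
qed

section \<open>Squares from fixed-point-free families\<close>

text \<open>Here \<open>d\<close> is meant to turn indices into group elements and \<open>e\<close>
  to turn values back into numbers. The restriction makes the square extensional, as
  \<open>latin_square\<close> requires.\<close>

definition grid_square :: "nat \<Rightarrow> (nat \<Rightarrow> 'a) \<Rightarrow> ('a \<Rightarrow> nat) \<Rightarrow> ('a \<times> 'a \<Rightarrow> 'a) \<Rightarrow> nat \<times> nat \<Rightarrow> nat" where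
  "grid_square n d e p = restrict (e \<circ> p \<circ> map_prod d d) (grid n)"

text \<open>
  The coordinate maps stand for the rows, the columns and the letters of the square of \<open>f\<close>.
\<close>
definition coordinate_maps ::
    "('a, 'b) monoid_scheme \<Rightarrow> ('a \<Rightarrow> 'a) set \<Rightarrow> ('a \<times> 'a \<Rightarrow> 'a) set" where
  "coordinate_maps M F = {fst, snd} \<union> (\<lambda>f (x, y). f x \<otimes>\<^bsub>M\<^esub> y) ` F"

text \<open>Commutativity allows the product of \<open>f x\<close>, \<open>f x'\<close>,
  \<open>y\<close>, \<open>y'\<close> to be regrouped as a product of two values of the map.\<close>

lemma coordinate_maps_hom:
  assumes "comm_group M" and "F \<subseteq> hom M M" and "p \<in> coordinate_maps M F"
  shows "p \<in> hom (M \<times>\<times> M) M"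
proof -
  interpret comm_group M by fact
  have "(\<lambda>(x, y). f x \<otimes>\<^bsub>M\<^esub> y) \<in> hom (M \<times>\<times> M) M" if "f \<in> F" for f
  proof (rule homI)
    have f: "f \<in> hom M M" using that assms(2) by blast
    note fc = hom_in_carrier[OF f]
    fix c assume "c \<in> carrier (M \<times>\<times> M)"
    then show "(case c of (x, y) \<Rightarrow> f x \<otimes>\<^bsub>M\<^esub> y) \<in> carrier M" using fc by auto
    fix c' assume "c' \<in> carrier (M \<times>\<times> M)"
    with \<open>c \<in> _\<close> show "(case c \<otimes>\<^bsub>M \<times>\<times> M\<^esub> c' of (x, y) \<Rightarrow> f x \<otimes>\<^bsub>M\<^esub> y) =
        (case c of (x, y) \<Rightarrow> f x \<otimes>\<^bsub>M\<^esub> y) \<otimes>\<^bsub>M\<^esub> (case c' of (x, y) \<Rightarrow> f x \<otimes>\<^bsub>M\<^esub> y)"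
      by (auto simp: hom_mult[OF f] fc m_ac)
  qed
  moreover have "fst \<in> hom (M \<times>\<times> M) M" "snd \<in> hom (M \<times>\<times> M) M"
    by (auto simp: hom_def)
  ultimately show ?thesis using assms(3) by (auto simp: coordinate_maps_def)
qed

text \<open>Only common kernels need checking. Triviality of the kernel of \<open>f\<close> handles
  the columns against a square. For two squares, cancelling \<open>y\<close> leaves
  \<open>f x = g x\<close>, which forces \<open>x\<close> to be the identity.\<close>

lemma coordinate_maps_orthogonal:
  assumes M: "comm_group M" and fin: "finite (carrier M)" and F: "F \<subseteq> hom M M"
    and inj: "\<And>f x. f \<in> F \<Longrightarrow> x \<in> carrier M \<Longrightarrow> f x = \<one>\<^bsub>M\<^esub> \<Longrightarrow> x = \<one>\<^bsub>M\<^esub>"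
    and ne: "\<And>f g x. f \<in> F \<Longrightarrow> g \<in> F \<Longrightarrow> f \<noteq> g \<Longrightarrow> x \<in> carrier M \<Longrightarrow> f x = g x \<Longrightarrow> x = \<one>\<^bsub>M\<^esub>"
    and p: "p \<in> coordinate_maps M F" and q: "q \<in> coordinate_maps M F" and "p \<noteq> q"
  shows "orthogonal_maps (M \<times>\<times> M) M p q"
proof -
  interpret comm_group M by fact
  let ?L = "\<lambda>f (x, y). f x \<otimes>\<^bsub>M\<^esub> y"
  have I: "orthogonal_maps (M \<times>\<times> M) M p q"
    if "p \<in> coordinate_maps M F" "q \<in> coordinate_maps M F"
      "\<And>x y. x \<in> carrier M \<Longrightarrow> y \<in> carrier M \<Longrightarrow> p (x, y) = \<one>\<^bsub>M\<^esub> \<Longrightarrow> q (x, y) = \<one>\<^bsub>M\<^esub> \<Longrightarrow>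
        x = \<one>\<^bsub>M\<^esub> \<and> y = \<one>\<^bsub>M\<^esub>" for p q
    by (rule orthogonal_mapsI)
      (use that fin coordinate_maps_hom[OF M F] in
        \<open>auto simp: card_cartesian_product intro: DirProd_group is_group\<close>)
  have mem: "fst \<in> coordinate_maps M F" "snd \<in> coordinate_maps M F"
    "\<And>f. f \<in> F \<Longrightarrow> ?L f \<in> coordinate_maps M F"
    by (auto simp: coordinate_maps_def)
  have f1: "f \<one>\<^bsub>M\<^esub> = \<one>\<^bsub>M\<^esub>" and fc: "\<And>x. x \<in> carrier M \<Longrightarrow> f x \<in> carrier M" if "f \<in> F" for f
    using that F hom_one[OF _ is_group is_group] by (auto simp: hom_def)
  have 1: "orthogonal_maps (M \<times>\<times> M) M fst snd"
    by (intro I mem) auto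
  have 2: "orthogonal_maps (M \<times>\<times> M) M fst (?L f)" if "f \<in> F" for f
    using that by (intro I mem) (auto simp: f1)
  have 3: "orthogonal_maps (M \<times>\<times> M) M snd (?L f)" if "f \<in> F" for f
  proof (intro I mem that)
    fix x y assume x: "x \<in> carrier M" and "snd (x, y) = \<one>\<^bsub>M\<^esub>" "?L f (x, y) = \<one>\<^bsub>M\<^esub>"
    then have y: "y = \<one>\<^bsub>M\<^esub>" and "f x = \<one>\<^bsub>M\<^esub>" using fc[OF that x] by auto
    then show "x = \<one>\<^bsub>M\<^esub> \<and> y = \<one>\<^bsub>M\<^esub>" using inj[OF that x] by blast
  qed
  have 4: "orthogonal_maps (M \<times>\<times> M) M (?L f) (?L g)" if fg: "f \<in> F" "g \<in> F" "f \<noteq> g" for f g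
  proof (intro I mem fg)
    fix x y assume x: "x \<in> carrier M" and y: "y \<in> carrier M"
      and "?L f (x, y) = \<one>\<^bsub>M\<^esub>" "?L g (x, y) = \<one>\<^bsub>M\<^esub>"
    then have f: "f x \<otimes>\<^bsub>M\<^esub> y = \<one>\<^bsub>M\<^esub>" and "g x \<otimes>\<^bsub>M\<^esub> y = \<one>\<^bsub>M\<^esub>" by auto
    then have "f x \<otimes>\<^bsub>M\<^esub> y = g x \<otimes>\<^bsub>M\<^esub> y" by simp
    then have "f x = g x" using x y fg by (simp add: fc)
    then have "x = \<one>\<^bsub>M\<^esub>" using ne[OF fg x] by blast
    then show "x = \<one>\<^bsub>M\<^esub> \<and> y = \<one>\<^bsub>M\<^esub>" using f y f1[OF fg(1)] by simp
  qed
  from p consider "p = fst" | "p = snd" | f where "f \<in> F" "p = ?L f"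
    by (auto simp: coordinate_maps_def)
  then show ?thesis
  proof cases
    case p: 1
    from q consider "q = snd" | f where "f \<in> F" "q = ?L f"
      using \<open>p \<noteq> q\<close> p by (auto simp: coordinate_maps_def)
    then show ?thesis by cases (simp_all only: p 1 2)
  next
    case p: 2
    from q consider "q = fst" | f where "f \<in> F" "q = ?L f"
      using \<open>p \<noteq> q\<close> p by (auto simp: coordinate_maps_def)
    then show ?thesis by cases (simp_all only: p 1[THEN orthogonal_maps_sym] 3)
  next
    case p: 3
    from q consider "q = fst" | "q = snd" | g where "g \<in> F" "q = ?L g" "f \<noteq> g"
      using \<open>p \<noteq> q\<close> p by (auto simp: coordinate_maps_def)
    then show ?thesis
      by cases (simp_all only: p 2[THEN orthogonal_maps_sym] 3[THEN orthogonal_maps_sym] 4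
        not_False_eq_True)
  qed
qed

text \<open>The coordinate maps are carried to the grid by numbering \<open>M\<close>. A non-trivial
  carrier keeps the squares of different members of \<open>F\<close> distinct.\<close>

lemma fixed_point_free_mols:
  fixes M :: "('a, 'b) monoid_scheme"
  assumes M: "comm_group M" and fin: "finite (carrier M)" and nontriv: "carrier M \<noteq> {\<one>\<^bsub>M\<^esub>}"
    and finF: "finite F" and F: "F \<subseteq> hom M M"
    and inj: "\<And>f x. f \<in> F \<Longrightarrow> x \<in> carrier M \<Longrightarrow> f x = \<one>\<^bsub>M\<^esub> \<Longrightarrow> x = \<one>\<^bsub>M\<^esub>"
    and ne: "\<And>f g x. f \<in> F \<Longrightarrow> g \<in> F \<Longrightarrow> f \<noteq> g \<Longrightarrow> x \<in> carrier M \<Longrightarrow> f x = g x \<Longrightarrow> x = \<one>\<^bsub>M\<^esub>"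
  shows "\<exists>S. mogs (card (carrier M)) S \<and> card S = card F \<and>
    (\<forall>A \<in> determined_squares (card (carrier M)) S. isotopic A (cayley_table M))"
proof -
  interpret comm_group M by fact
  let ?C = "carrier M \<times> carrier M" and ?P = "coordinate_maps M F"
  let ?L = "\<lambda>f (x, y). f x \<otimes>\<^bsub>M\<^esub> y"
  define n where "n = card (carrier M)"
  obtain d where d: "bij_betw d {..<n} (carrier M)"
    using ex_bij_betw_nat_finite[OF fin] by (auto simp: n_def lessThan_atLeast0)
  define e where "e = inv_into {..<n} d"
  have e: "bij_betw e (carrier M) {..<n}" unfolding e_def by (rule bij_betw_inv_into[OF d])
  have de: "d (e x) = x" if "x \<in> carrier M" for x
    unfolding e_def using d that by (rule bij_betw_inv_into_right)
  have dc: "d i \<in> carrier M" if "i < n" for i using d that by (auto simp: bij_betw_def)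
  have ec: "e x < n" if "x \<in> carrier M" for x using e that by (auto simp: bij_betw_def)
  have d_eq: "i = j" if "d i = d j" "i < n" "j < n" for i j
    using d that by (auto simp: bij_betw_def dest: inj_onD)
  have e_eq: "x = y" if "e x = e y" "x \<in> carrier M" "y \<in> carrier M" for x y
    using that de by metis
  have dd: "bij_betw (map_prod d d) (grid n) ?C"
    unfolding grid_def using d d by (rule bij_betw_map_prod)
  have hom: "p \<in> hom (M \<times>\<times> M) M" if "p \<in> ?P" for p
    using coordinate_maps_hom[OF M F that] .
  have pc: "p c \<in> carrier M" if "p \<in> ?P" "c \<in> ?C" for p c
    using hom_in_carrier[OF hom[OF that(1)], of c] that(2) by auto
  have orth: "orthogonal_maps (M \<times>\<times> M) M p q" if "p \<in> ?P" "q \<in> ?P" "p \<noteq> q" for p q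
    using coordinate_maps_orthogonal[OF M fin F inj ne that] .
  have memP: "fst \<in> ?P" "snd \<in> ?P" "\<And>f. f \<in> F \<Longrightarrow> ?L f \<in> ?P"
    by (auto simp: coordinate_maps_def)
  \<comment> \<open>Orthogonality is available only for coordinate maps that differ as functions.
    Evaluating at the pairs formed from \<open>u\<close> and the identity tells them apart.\<close>
  obtain u where u: "u \<in> carrier M" "u \<noteq> \<one>\<^bsub>M\<^esub>" using nontriv one_closed by blast
  have one_u: "?L f (\<one>\<^bsub>M\<^esub>, u) = u" "?L f (u, \<one>\<^bsub>M\<^esub>) = f u" if "f \<in> F" for f
  proof -
    have f: "f \<in> hom M M" using that F by blast
    show "?L f (\<one>\<^bsub>M\<^esub>, u) = u" using u hom_one[OF f is_group is_group] by simp
    show "?L f (u, \<one>\<^bsub>M\<^esub>) = f u" using hom_in_carrier[OF f u(1)] by simp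
  qed
  have L_ne: "?L f \<noteq> fst" "?L f \<noteq> snd" if "f \<in> F" for f
  proof -
    show "?L f \<noteq> fst" using one_u(1)[OF that] u by (metis fst_conv)
    show "?L f \<noteq> snd" using one_u(2)[OF that] inj[OF that u(1)] u(2) by (metis snd_conv)
  qed
  have L_eq: "f = g" if "f \<in> F" "g \<in> F" "f u = g u" for f g
    using ne[OF that(1,2) _ u(1) that(3)] u(2) by blast
  have L_neq: "?L f \<noteq> ?L g" if "f \<in> F" "g \<in> F" "f \<noteq> g" for f g
    using one_u(2)[OF that(1)] one_u(2)[OF that(2)] L_eq[OF that(1,2)] that(3) by metis
  let ?S = "(\<lambda>f. grid_square n d e (?L f)) ` F"
  have sq: "grid_square n d e p (i, j) = e (p (d i, d j))" if "i < n" "j < n" for p i j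
    using that by (simp add: grid_square_def grid_def)
  \<comment> \<open>Orthogonality to \<open>fst\<close> and to \<open>snd\<close> makes each row and
    each column injective, and an injective self-map of a finite set is bijective.\<close>
  have latin: "latin_square n (grid_square n d e (?L f))" if f: "f \<in> F" for f
  proof -
    let ?l = "grid_square n d e (?L f)"
    have lt: "?l (i, j) < n" if "i < n" "j < n" for i j
      unfolding sq[OF that] by (intro ec pc memP f) (simp add: dc that)
    have eq: "(d i, d j) = (d i', d j')"
      if "i < n" "j < n" "i' < n" "j' < n" "?l (i, j) = ?l (i', j')"
        "p \<in> {fst, snd}" "p (d i, d j) = p (d i', d j')" for i j i' j' p
    proof -
      have c: "(d i, d j) \<in> ?C" "(d i', d j') \<in> ?C" using that(1-4) dc by auto
      have "e (?L f (d i, d j)) = e (?L f (d i', d j'))"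
        using that(5) unfolding sq[OF that(1,2)] sq[OF that(3,4)] .
      then have "?L f (d i, d j) = ?L f (d i', d j')"
        by (rule e_eq) (intro pc memP f c)+
      moreover have "orthogonal_maps (M \<times>\<times> M) M p (?L f)"
        using that(6) L_ne[OF f] by (intro orth memP f) (auto simp: memP)
      ultimately show ?thesis
        using that(7) c by (intro orthogonal_maps_inj[of "M \<times>\<times> M" M p "?L f"]) simp_all
    qed
    have bij: "bij_betw h {..<n} {..<n}" if "h \<in> {..<n} \<rightarrow> {..<n}" "inj_on h {..<n}" for h :: "nat \<Rightarrow> nat"
      using that endo_inj_surj[of "{..<n}" h] by (auto simp: bij_betw_def)
    have "bij_betw (\<lambda>j. ?l (i, j)) {..<n} {..<n}" if i: "i < n" for i
    proof (rule bij)
      show "inj_on (\<lambda>j. ?l (i, j)) {..<n}"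
      proof (rule inj_onI)
        fix j j' assume "j \<in> {..<n}" "j' \<in> {..<n}" "?l (i, j) = ?l (i, j')"
        then show "j = j'" using eq[of i j i j' fst] i d_eq[of j j'] by simp
      qed
    qed (simp add: lt i)
    moreover have "bij_betw (\<lambda>i. ?l (i, j)) {..<n} {..<n}" if j: "j < n" for j
    proof (rule bij)
      show "inj_on (\<lambda>i. ?l (i, j)) {..<n}"
      proof (rule inj_onI)
        fix i i' assume "i \<in> {..<n}" "i' \<in> {..<n}" "?l (i, j) = ?l (i', j)"
        then show "i = i'" using eq[of i j i' j snd] j d_eq[of i i'] by simp
      qed
    qed (simp add: lt j)
    moreover have "?l \<in> grid n \<rightarrow>\<^sub>E {..<n}"
      using lt by (auto simp: grid_square_def grid_def)
    ultimately show ?thesis by (simp add: latin_square_def)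
  qed
  have orthogonal: "orthogonal_squares n (grid_square n d e p) (grid_square n d e q)"
    if pq: "p \<in> ?P" "q \<in> ?P" "p \<noteq> q" for p q
  proof -
    have "bij_betw (\<lambda>c. (p c, q c)) ?C ?C"
      using orth[OF pq] by (simp add: orthogonal_maps_def)
    from bij_betw_trans[OF bij_betw_trans[OF dd this] bij_betw_map_prod[OF e e]]
    show ?thesis unfolding orthogonal_squares_def
      by (rule bij_betw_cong[THEN iffD1, rotated]) (auto simp: grid_square_def)
  qed
  \<comment> \<open>A square coming from two distinct maps would be orthogonal to itself. Then only
    pairs with equal entries would occur, and \<open>(e u, e \<one>)\<close> would be
    missing.\<close>
  have inj_square: "inj_on (\<lambda>f. grid_square n d e (?L f)) F"
  proof (rule inj_onI)
    fix f g assume fg: "f \<in> F" "g \<in> F" and eq: "grid_square n d e (?L f) = grid_square n d e (?L g)"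
    show "f = g"
    proof (rule ccontr)
      assume "f \<noteq> g"
      then have "orthogonal_squares n (grid_square n d e (?L f)) (grid_square n d e (?L g))"
        by (intro orthogonal memP fg L_neq)
      then have "(\<lambda>c. (grid_square n d e (?L f) c, grid_square n d e (?L f) c)) ` grid n =
          {..<n} \<times> {..<n}"
        by (simp add: orthogonal_squares_def bij_betw_def eq)
      moreover have "(e u, e \<one>\<^bsub>M\<^esub>) \<in> {..<n} \<times> {..<n}" using ec u by simp
      ultimately have "(e u, e \<one>\<^bsub>M\<^esub>) \<in>
          (\<lambda>c. (grid_square n d e (?L f) c, grid_square n d e (?L f) c)) ` grid n"
        by (simp only:)
      then have "e u = e \<one>\<^bsub>M\<^esub>" by (elim imageE) simp
      then show False using e_eq u by blast
    qed
  qed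
  have mols: "mols n ?S"
    unfolding mols_def
  proof (intro conjI ballI impI)
    show "finite ?S" using finF by simp
  next
    fix L assume "L \<in> ?S"
    then show "latin_square n L" using latin by auto
  next
    fix L K assume "L \<in> ?S" "K \<in> ?S" "L \<noteq> K"
    then obtain f g where fg: "f \<in> F" "g \<in> F" "L = grid_square n d e (?L f)" "K = grid_square n d e (?L g)"
      "f \<noteq> g" by blast
    then show "orthogonal_squares n L K"
      unfolding fg(3,4) by (intro orthogonal memP L_neq)
  qed
  \<comment> \<open>Each partition of the grid is the family of fibres of a coordinate map read
    through \<open>d\<close>, so \<open>map_prod d d\<close> carries it to fibres on pairs of group
    elements.\<close>
  let ?fib = "\<lambda>p. fibres (grid n) (p \<circ> map_prod d d) (carrier M)"
  have row: "row_partition n = ?fib fst"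
  proof -
    have "row_partition n = fibres (grid n) fst {..<n}"
      by (auto simp: row_partition_def fibres_def grid_def intro!: image_cong)
    also have "\<dots> = ?fib fst" by (rule fibres_cong[OF d]) (auto simp: grid_def)
    finally show ?thesis .
  qed
  have col: "column_partition n = ?fib snd"
  proof -
    have "column_partition n = fibres (grid n) snd {..<n}"
      by (auto simp: column_partition_def fibres_def grid_def intro!: image_cong)
    also have "\<dots> = ?fib snd" by (rule fibres_cong[OF d]) (auto simp: grid_def)
    finally show ?thesis .
  qed
  have let_part: "letter_partition n (grid_square n d e p) = ?fib p" if p: "p \<in> ?P" for p
  proof -
    have "?fib p = fibres (grid n) (grid_square n d e p) {..<n}"
      by (rule fibres_cong[OF e]) (use bij_betwE[OF dd] pc[OF p] in \<open>auto simp: grid_square_def\<close>)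
    then show ?thesis by (simp add: letter_partition_def fibres_def)
  qed
  have part: "\<exists>p\<in>?P. X = ?fib p" if "X \<in> mols_partitions n ?S" for X
    using that row col let_part memP unfolding mols_partitions_def by blast
  have iso: "isotopic A (cayley_table M)" if A: "A \<in> determined_squares n ?S" for A
  proof -
    obtain X Y Z where XYZ: "A = \<lparr>cells = grid n, rows = X, columns = Y, letters = Z\<rparr>"
      "X \<in> mols_partitions n ?S" "Y \<in> mols_partitions n ?S" "Z \<in> mols_partitions n ?S"
      "X \<noteq> Y" "X \<noteq> Z" "Y \<noteq> Z" using A unfolding determined_squares_def by blast
    obtain p q r where pqr: "p \<in> ?P" "q \<in> ?P" "r \<in> ?P" "X = ?fib p" "Y = ?fib q" "Z = ?fib r"
      using part[OF XYZ(2)] part[OF XYZ(3)] part[OF XYZ(4)] by blast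
    \<comment> \<open>Distinct partitions can only come from distinct coordinate maps, which gives
      the pairwise orthogonality used below.\<close>
    have neq: "p \<noteq> q" "p \<noteq> r" "q \<noteq> r" using XYZ(5-7) pqr(4-6) by blast+
    have id: "bij_betw id (carrier M) (carrier M)" by simp
    have im: "image (map_prod d d) ` ?fib s = fibres ?C s (carrier M)" if "s \<in> ?P" for s
      by (rule image_fibres[OF dd id]) (use bij_betwE[OF dd] pc[OF that] in auto)
    have "isotopism (map_prod d d) A \<lparr>cells = ?C, rows = fibres ?C p (carrier M),
        columns = fibres ?C q (carrier M), letters = fibres ?C r (carrier M)\<rparr>"
      unfolding isotopism_def XYZ(1) pqr(4-6) square.simps
      using dd im pqr(1-3) by blast
    moreover have "isotopic \<lparr>cells = ?C, rows = fibres ?C p (carrier M),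
        columns = fibres ?C q (carrier M), letters = fibres ?C r (carrier M)\<rparr> (cayley_table M)"
      using orthogonal_maps_isotopic_cayley_table[OF DirProd_group[OF is_group is_group] is_group
          hom[OF pqr(1)] hom[OF pqr(2)] hom[OF pqr(3)] orth[OF pqr(1,2) neq(1)]
          orth[OF pqr(1,3) neq(2)] orth[OF pqr(2,3) neq(3)]] by simp
    ultimately show ?thesis using isotopic_trans isotopic_def by blast
  qed
  obtain K :: "nat monoid" and h where K: "group K" "h \<in> iso M K"
    using finite_group_iso_nat[OF is_group fin] by blast
  have "\<exists>K :: nat monoid. group K \<and> isotopic A (cayley_table K)"
    if "A \<in> determined_squares n ?S" for A
    using isotopic_trans[OF iso[OF that] isotopic_cayley_table_iso[OF is_group K(2)]] K(1) by blast
  then have "mogs n ?S" using mols by (simp add: mogs_def)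
  moreover have "card ?S = card F" using inj_square by (rule card_image)
  ultimately show ?thesis using iso unfolding n_def by blast
qed

section \<open>The complement acting on the kernel by conjugation\<close>

theorem theorem3:
  fixes G :: "('a, 'b) monoid_scheme" and H N :: "'a set"
  assumes "frobenius_complement G H"
    and "N = frobenius_kernel G H"
    and "\<forall>x \<in> N. \<forall>y \<in> N. x \<otimes>\<^bsub>G\<^esub> y = y \<otimes>\<^bsub>G\<^esub> x"
  shows "\<exists>S. mogs (card N) S \<and> card S = card H \<and>
           (\<forall>A \<in> determined_squares (card N) S. isotopic A (cayley_table (G\<lparr>carrier := N\<rparr>)))"
proof -
  note fc = assms(1)
  interpret group G using fc by (simp add: frobenius_complement_def)
  have H: "subgroup H G" and finG: "finite (carrier G)"
    using fc by (auto simp: frobenius_complement_def)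
  interpret H: subgroup H G by (rule H)
  let ?M = "G\<lparr>carrier := N\<rparr>"
  have N: "subgroup N G"
    unfolding assms(2) by (rule subgroup_frobenius_kernel[OF fc]) (use assms(2,3) in blast)
  interpret N: subgroup N G by (rule N)
  have finN: "finite N" and finH: "finite H"
    using finG N.subset H.subset finite_subset by blast+
  have M: "comm_group ?M"
    by (rule group.group_comm_groupI[OF subgroup_imp_group[OF N]]) (use assms(3) in simp)
  obtain u where u: "u \<in> N" "u \<noteq> \<one>\<^bsub>G\<^esub>"
    using frobenius_kernel_nontrivial[OF fc] N.one_closed unfolding assms(2) by blast
  define \<phi> where "\<phi> h x = h \<otimes>\<^bsub>G\<^esub> x \<otimes>\<^bsub>G\<^esub> inv\<^bsub>G\<^esub> h" for h x
  have fpf: "x = \<one>\<^bsub>G\<^esub>" if "h \<in> H" "k \<in> H" "h \<noteq> k" "x \<in> N" "\<phi> h x = \<phi> k x" for h k x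
    using frobenius_kernel_conj_eq[OF fc, of x h k] that unfolding \<phi>_def assms(2) by blast
  have "\<phi> h \<in> hom ?M ?M" if h: "h \<in> H" for h
  proof (rule homI)
    fix x y assume "x \<in> carrier ?M" and y: "y \<in> carrier ?M"
    then show "\<phi> h (x \<otimes>\<^bsub>?M\<^esub> y) = \<phi> h x \<otimes>\<^bsub>?M\<^esub> \<phi> h y"
      using h by (simp add: \<phi>_def m_assoc inv_cancel)
  qed (use h frobenius_kernel_conj[OF H] in \<open>simp add: \<phi>_def assms(2)\<close>)
  then have hom: "\<phi> ` H \<subseteq> hom ?M ?M" by blast
  \<comment> \<open>Two elements of \<open>H\<close> with the same action agree at the non-identity
    element \<open>u\<close>, so fixed-point-freeness makes them equal. Hence the family has exactly
    |H| members.\<close>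
  have "inj_on \<phi> H"
    using fpf[OF _ _ _ u(1)] u(2) by (intro inj_onI) metis
  then have card: "card (\<phi> ` H) = card H" by (rule card_image)
  have "\<exists>S. mogs (card (carrier ?M)) S \<and> card S = card (\<phi> ` H) \<and>
    (\<forall>A \<in> determined_squares (card (carrier ?M)) S. isotopic A (cayley_table ?M))"
  proof (rule fixed_point_free_mols[OF M _ _ _ hom])
    show "finite (carrier ?M)" and "finite (\<phi> ` H)" using finN finH by auto
    show "carrier ?M \<noteq> {\<one>\<^bsub>?M\<^esub>}" using u by auto
  next
    fix f x assume "f \<in> \<phi> ` H" "x \<in> carrier ?M" "f x = \<one>\<^bsub>?M\<^esub>"
    then show "x = \<one>\<^bsub>?M\<^esub>" by (auto simp: \<phi>_def conj_eq_one_iff)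
  next
    fix f g x assume "f \<in> \<phi> ` H" "g \<in> \<phi> ` H" "f \<noteq> g" "x \<in> carrier ?M" "f x = g x"
    then show "x = \<one>\<^bsub>?M\<^esub>" using fpf by auto
  qed
  then show ?thesis unfolding card by simp
qed

end
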